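(* Let $n$ be a positive integer. For $k=1,2$, let $\mathcal{H}_k$ be a separable complex Hilbert space, let $T_k\in B(\mathcal{H}_k)$ be an operator that admits an extension that is $m$--normal for every $m\ge n$, and let $S_k$ be a minimal $n$--normal extension of $T_k$, acting on a Hilbert space $\mathcal{K}_k\supseteq\mathcal{H}_k$. If $T_1$ and $T_2$ are unitarily equivalent, then so are the minimal $n$--normal extensions $S_1$ and $S_2$.
   Context: An operator $S\in B(\mathcal{K})$ is $m$--normal if $S^*S^m=S^mS^*$; equivalently, $S^m$ is normal. $S\in B(\mathcal{K})$ is an extension of $T\in B(\mathcal{H})$ if $\mathcal{H}\subseteq\mathcal{K}$ and $Sx=Tx$ for all $x\in\mathcal{H}$. An $n$--normal extension $S\in B(\mathcal{K})$ of $T\in B(\mathcal{H})$ is minimal if the only closed subspace $\mathcal{M}$ with $\mathcal{H}\subseteq\mathcal{M}\subseteq\mathcal{K}$, $S\mathcal{M}\subseteq\mathcal{M}$, and $S|_{\mathcal{M}}$ an $n$--normal extension of $T$, is $\mathcal{M}=\mathcal{K}$. *)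

theory Defs
  imports "HOL-Analysis.Analysis"
begin

(* The library has no complex inner product spaces.  A complex inner product is introduced
   on top of the library's real one: the underlying real inner product is its real part, so
   that norm, metric and topology are the library's.  Positive definiteness is inherited
   from real_inner.  The complex inner product is linear in the first argument. *)

class complex_inner = real_inner +
  fixes scaleC :: "complex \<Rightarrow> 'a \<Rightarrow> 'a" (infixr "*\<^sub>C" 75)
    and cinner :: "'a \<Rightarrow> 'a \<Rightarrow> complex"
  assumes scaleC_of_real: "of_real r *\<^sub>C x = r *\<^sub>R x"
    and scaleC_add_right: "a *\<^sub>C (x + y) = a *\<^sub>C x + a *\<^sub>C y"
    and scaleC_add_left: "(a + b) *\<^sub>C x = a *\<^sub>C x + b *\<^sub>C x"
    and scaleC_scaleC: "a *\<^sub>C (b *\<^sub>C x) = (a * b) *\<^sub>C x"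
    and cinner_commute: "cinner x y = cnj (cinner y x)"
    and cinner_add_left: "cinner (x + y) z = cinner x z + cinner y z"
    and cinner_scaleC_left: "cinner (a *\<^sub>C x) y = a * cinner x y"
    and Re_cinner: "Re (cinner x y) = inner x y"

class chilbert_space = complex_inner + complete_space

definition csubspace :: "'a::complex_inner set \<Rightarrow> bool" where
  "csubspace M \<longleftrightarrow> subspace M \<and> (\<forall>a. \<forall>x\<in>M. a *\<^sub>C x \<in> M)"

definition clinear :: "('a::complex_inner \<Rightarrow> 'b::complex_inner) \<Rightarrow> bool" where
  "clinear f \<longleftrightarrow> linear f \<and> (\<forall>a x. f (a *\<^sub>C x) = a *\<^sub>C f x)"

definition bounded_clinear :: "('a::complex_inner \<Rightarrow> 'b::complex_inner) \<Rightarrow> bool" where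
  "bounded_clinear f \<longleftrightarrow> bounded_linear f \<and> clinear f"

definition isometric_embedding :: "('a::complex_inner \<Rightarrow> 'b::complex_inner) \<Rightarrow> bool" where
  "isometric_embedding J \<longleftrightarrow> clinear J \<and> (\<forall>x y. cinner (J x) (J y) = cinner x y)"

definition unitarily_equivalent ::
    "('a::complex_inner \<Rightarrow> 'a) \<Rightarrow> ('b::complex_inner \<Rightarrow> 'b) \<Rightarrow> bool" where
  "unitarily_equivalent A B \<longleftrightarrow>
    (\<exists>U::'a \<Rightarrow> 'b. isometric_embedding U \<and> surj U \<and> (\<forall>x. U (A x) = B (U x)))"

(* Hilbert space adjoint of the restriction of A to M, taken in B(M) and not in the ambient
   space.  If M is a closed complex subspace and A is bounded with A ` M \<subseteq> M, then for each
   y in M the described vector exists (Riesz) and is unique.  M = UNIV gives the usual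
   adjoint of A. *)
definition adjoint_on :: "'a::chilbert_space set \<Rightarrow> ('a \<Rightarrow> 'a) \<Rightarrow> 'a \<Rightarrow> 'a" where
  "adjoint_on M A y = (THE z. z \<in> M \<and> (\<forall>x\<in>M. cinner (A x) y = cinner x z))"

definition m_normal_on :: "nat \<Rightarrow> 'a::chilbert_space set \<Rightarrow> ('a \<Rightarrow> 'a) \<Rightarrow> bool" where
  "m_normal_on m M A \<longleftrightarrow>
    (\<forall>x\<in>M. adjoint_on M A ((A ^^ m) x) = (A ^^ m) (adjoint_on M A x))"

(* The restriction of S to the invariant closed subspace M is an m-normal extension of T.
   The inclusion of the space of T into M is the isometric embedding J. *)
definition m_normal_extension_on ::
    "nat \<Rightarrow> ('h::chilbert_space \<Rightarrow> 'k::chilbert_space) \<Rightarrow> ('h \<Rightarrow> 'h) \<Rightarrow> 'k set \<Rightarrow> ('k \<Rightarrow> 'k) \<Rightarrow> bool"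
  where
  "m_normal_extension_on m J T M S \<longleftrightarrow>
    closed M \<and> csubspace M \<and> S ` M \<subseteq> M \<and>
    isometric_embedding J \<and> range J \<subseteq> M \<and> (\<forall>x. S (J x) = J (T x)) \<and>
    m_normal_on m M S"

definition m_normal_extension ::
    "nat \<Rightarrow> ('h::chilbert_space \<Rightarrow> 'k::chilbert_space) \<Rightarrow> ('h \<Rightarrow> 'h) \<Rightarrow> ('k \<Rightarrow> 'k) \<Rightarrow> bool"
  where
  "m_normal_extension m J T S \<longleftrightarrow> bounded_clinear S \<and> m_normal_extension_on m J T UNIV S"

definition minimal_m_normal_extension ::
    "nat \<Rightarrow> ('h::chilbert_space \<Rightarrow> 'k::chilbert_space) \<Rightarrow> ('h \<Rightarrow> 'h) \<Rightarrow> ('k \<Rightarrow> 'k) \<Rightarrow> bool"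
  where
  "minimal_m_normal_extension m J T S \<longleftrightarrow>
    m_normal_extension m J T S \<and> (\<forall>M. m_normal_extension_on m J T M S \<longrightarrow> M = UNIV)"

end

theory Submission
  imports Defs
begin

text \<open>
  Let \<open>S\<close> be an \<open>n\<close>-normal extension of \<open>T\<close>, and let \<open>A\<close> be the adjoint of \<open>S ^^ n\<close>. Taking
  adjoints in the defining identity of \<open>n\<close>-normality shows that \<open>A\<close> commutes with \<open>S\<close>
  (\<open>adjoint_power_commute\<close>). Let \<open>M\<close> be the closed span of the vectors \<open>(A ^^ j) (J h)\<close>. It is
  invariant under \<open>A\<close>, and under \<open>S\<close> because \<open>S ((A ^^ j) (J h)) = (A ^^ j) (J (T h))\<close>.
  Hence \<open>M\<close> reduces \<open>S ^^ n\<close>, and so the restriction of \<open>S\<close> to \<open>M\<close> is again \<open>n\<close>-normal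
  (\<open>m_normal_on_invariant_subspace\<close>). If \<open>S\<close> is minimal, then \<open>M\<close> is the whole space
  (\<open>minimal_extension_dense\<close>).

  On these spanning vectors everything is dictated by \<open>T\<close>: the formula above gives the action
  of \<open>S\<close>, and moving powers of \<open>A\<close> across the inner product gives
  \<open>cinner ((A ^^ j) (J h)) ((A ^^ k) (J g)) = cinner ((T ^^ (n * k)) h) ((T ^^ (n * j)) g)\<close>
  (\<open>extension_gram\<close>). So, when \<open>V\<close> is a unitary from \<open>T1\<close> to \<open>T2\<close>, the correspondence
  between \<open>(A1 ^^ j) (J1 h)\<close> and \<open>(A2 ^^ j) (J2 (V h))\<close> preserves inner products and intertwines
  \<open>S1\<close> with \<open>S2\<close>. The closed span of this correspondence in the product space is the graph of a
  unitary (\<open>unitarily_equivalent_if_correspondence\<close>).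
\<close>

section \<open>The complex inner product\<close>

lemma cinner_scaleC_right: "cinner x (a *\<^sub>C y) = cnj a * cinner x y"
  by (metis cinner_commute cinner_scaleC_left complex_cnj_mult)

lemma Im_cinner: "Im (cinner x y) = - inner (\<i> *\<^sub>C x) y"
  by (simp flip: Re_cinner add: cinner_scaleC_left)

lemma norm_scaleC: "norm (a *\<^sub>C x) = cmod a * norm x"
proof -
  have "cinner (a *\<^sub>C x) (a *\<^sub>C x) = of_real ((cmod a)\<^sup>2) * cinner x x"
    unfolding cinner_scaleC_left cinner_scaleC_right
    by (simp only: complex_norm_square mult_ac)
  then have "inner (a *\<^sub>C x) (a *\<^sub>C x) = (cmod a)\<^sup>2 * inner x x"
    by (simp flip: Re_cinner)
  then show ?thesis
    by (simp add: norm_eq_sqrt_inner real_sqrt_mult)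
qed

lemma bounded_clinear_scaleC: "bounded_clinear (\<lambda>x. a *\<^sub>C x)"
proof -
  have "a *\<^sub>C (r *\<^sub>R x) = r *\<^sub>R (a *\<^sub>C x)" for r and x :: 'a
    by (simp flip: scaleC_of_real add: scaleC_scaleC mult.commute)
  then have "bounded_linear (\<lambda>x::'a. a *\<^sub>C x)"
    by (intro bounded_linear_intro[where K = "cmod a"])
      (simp_all add: scaleC_add_right norm_scaleC mult.commute)
  then show ?thesis
    by (auto simp: bounded_clinear_def clinear_def bounded_linear.linear scaleC_scaleC mult.commute)
qed

lemma bounded_clinear_imp_bounded_linear: "bounded_clinear f \<Longrightarrow> bounded_linear f"
  by (simp add: bounded_clinear_def)

lemma bounded_clinear_scaleC_commute: "bounded_clinear f \<Longrightarrow> f (a *\<^sub>C x) = a *\<^sub>C f x"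
  by (simp add: bounded_clinear_def clinear_def)

lemma bounded_clinear_funpow:
  fixes f :: "'a::complex_inner \<Rightarrow> 'a"
  assumes "bounded_clinear f"
  shows "bounded_clinear (f ^^ n)"
proof (induction n)
  case 0
  then show ?case
    by (simp add: bounded_clinear_def clinear_def id_def bounded_linear.linear bounded_linear_ident)
next
  case (Suc n)
  then show ?case
    using assms
    by (auto simp: bounded_clinear_def clinear_def o_def
        intro: bounded_linear_compose bounded_linear.linear)
qed

lemma cinner_eq_imp_eq:
  assumes "subspace M" "y \<in> M" "z \<in> M" and eq: "\<And>x. x \<in> M \<Longrightarrow> cinner x y = cinner x z"
  shows "y = z"
proof -
  have "y - z \<in> M"
    using assms by (simp add: subspace_diff)
  then have "inner (y - z) y = inner (y - z) z"
    using eq by (metis Re_cinner)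
  then have "inner (y - z) (y - z) = 0"
    by (simp add: inner_diff_right)
  then show ?thesis by simp
qed

section \<open>Riesz representation and adjoints\<close>

text \<open>The representing vector is the minimiser over \<open>M\<close> of \<open>inner x x - 2 * f x\<close>. By the
  parallelogram law a minimising sequence is Cauchy, and the vanishing of the first variation at
  the minimiser is the claimed identity.\<close>

lemma riesz_on_closed_subspace:
  fixes f :: "'a::{real_inner,complete_space} \<Rightarrow> real"
  assumes f: "bounded_linear f" and "closed M" and M: "subspace M"
  obtains z where "z \<in> M" "\<And>x. x \<in> M \<Longrightarrow> f x = inner x z"
proof -
  interpret f: bounded_linear f by (rule f)
  define F where "F x = inner x x - 2 * f x" for x
  define m where "m = Inf (F ` M)"
  obtain K where K: "\<And>x. norm (f x) \<le> norm x * K"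
    using f.bounded by blast
  have "- K\<^sup>2 \<le> F x" for x
  proof -
    have "f x \<le> norm x * K" using K[of x] by simp
    moreover have "0 \<le> (norm x - K)\<^sup>2" by simp
    ultimately show ?thesis
      unfolding F_def power2_norm_eq_inner[symmetric] power2_diff by linarith
  qed
  then have bdd: "bdd_below (F ` M)" by (intro bdd_belowI2)
  have m_le: "m \<le> F x" if "x \<in> M" for x
    unfolding m_def using bdd that by (simp add: cInf_lower)
  have "F ` M \<noteq> {}" using subspace_0[OF M] by auto
  then have "\<exists>x\<in>M. F x < m + 1 / real (Suc k)" for k
    using cInf_lessD[of "F ` M" "m + 1 / real (Suc k)"] by (auto simp: m_def)
  then obtain X where X: "\<And>k. X k \<in> M" "\<And>k. F (X k) < m + 1 / real (Suc k)"
    by metis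
  have parallelogram: "(norm (x - y))\<^sup>2 \<le> 2 * (F x - m) + 2 * (F y - m)"
    if "x \<in> M" "y \<in> M" for x y
  proof -
    have "(1/2) *\<^sub>R (x + y) \<in> M"
      using that M by (simp add: subspace_add subspace_scale)
    from m_le[OF this] show ?thesis
      by (simp add: F_def power2_norm_eq_inner inner_diff inner_add f.add f.scaleR inner_commute
          algebra_simps)
  qed
  have "Cauchy X"
  proof (rule metric_CauchyI)
    fix e :: real assume "0 < e"
    then obtain N where N: "1 / real (Suc N) < e\<^sup>2 / 4"
      using nat_approx_posE[of "e\<^sup>2 / 4"] by auto
    have "dist (X j) (X k) < e" if "N \<le> j" "N \<le> k" for j k
    proof -
      have small: "F (X i) - m < e\<^sup>2 / 4" if "N \<le> i" for i
      proof -
        have "1 / real (Suc i) \<le> 1 / real (Suc N)"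
          using that by (simp add: frac_le)
        then show ?thesis using X(2)[of i] N by linarith
      qed
      have "(norm (X j - X k))\<^sup>2 \<le> 2 * (F (X j) - m) + 2 * (F (X k) - m)"
        by (intro parallelogram X(1))
      also have "\<dots> < 2 * (e\<^sup>2 / 4) + 2 * (e\<^sup>2 / 4)"
        by (intro add_strict_mono mult_strict_left_mono small that zero_less_numeral)
      also have "\<dots> = e\<^sup>2" by simp
      finally have "(norm (X j - X k))\<^sup>2 < e\<^sup>2" .
      then show ?thesis
        using \<open>0 < e\<close> by (simp add: dist_norm power_less_imp_less_base)
    qed
    then show "\<exists>N. \<forall>j\<ge>N. \<forall>k\<ge>N. dist (X j) (X k) < e" by blast
  qed
  then obtain z where z: "X \<longlonglongrightarrow> z"
    using Cauchy_convergent convergent_def by blast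
  have "z \<in> M"
    using closed_sequentially[OF \<open>closed M\<close> _ z] X(1) by blast
  have "(\<lambda>k. F (X k)) \<longlonglongrightarrow> F z"
    unfolding F_def by (intro tendsto_intros f.tendsto z)
  moreover have "(\<lambda>k. m + 1 / real (Suc k)) \<longlonglongrightarrow> m + 0"
    by (rule tendsto_add[OF tendsto_const LIMSEQ_Suc[OF lim_1_over_n]])
  ultimately have "F z \<le> m + 0"
    by (rule LIMSEQ_le) (intro exI allI impI less_imp_le X(2))
  then have "F z \<le> m" by simp
  have "f x = inner x z" if "x \<in> M" for x
  proof (cases "x = 0")
    case True
    then show ?thesis by (simp add: f.zero)
  next
    case False
    define d where "d = inner x z - f x"
    \<comment> \<open>the step that minimises the quadratic polynomial \<open>F (z + t *\<^sub>R x)\<close> in \<open>t\<close>\<close>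
    define t where "t = - d / inner x x"
    have pos: "inner x x > 0" using False by simp
    have "z + t *\<^sub>R x \<in> M"
      using \<open>z \<in> M\<close> that M by (simp add: subspace_add subspace_scale)
    then have "F z \<le> F (z + t *\<^sub>R x)"
      using \<open>F z \<le> m\<close> m_le by force
    moreover have "F (z + t *\<^sub>R x) = F z + 2 * t * d + t * t * inner x x"
      by (simp add: F_def d_def inner_add f.add f.scaleR inner_commute algebra_simps)
    moreover have "2 * t * d + t * t * inner x x = - (d * d) / inner x x"
      using pos by (simp add: t_def field_simps)
    ultimately have "0 \<le> - (d * d) / inner x x" by simp
    then have "d * d \<le> 0"
      using pos by (simp add: zero_le_divide_iff divide_le_0_iff)
    then have "d = 0" by (metis mult_eq_0_iff order_antisym zero_le_square)
    then show ?thesis by (simp add: d_def)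
  qed
  with \<open>z \<in> M\<close> show ?thesis using that by blast
qed

lemma adjoint_on_unique:
  assumes "csubspace M" "z \<in> M" "\<And>x. x \<in> M \<Longrightarrow> cinner (A x) y = cinner x z"
  shows "adjoint_on M A y = z"
  unfolding adjoint_on_def
proof (rule the_equality)
  fix w assume "w \<in> M \<and> (\<forall>x\<in>M. cinner (A x) y = cinner x w)"
  then show "w = z"
    using assms cinner_eq_imp_eq[of M w z] by (simp add: csubspace_def)
qed (use assms in auto)

text \<open>The real Riesz theorem only represents the real part of \<open>\<lambda>x. cinner (A x) y\<close>; the
  imaginary part follows by evaluating at \<open>\<i> *\<^sub>C x\<close>.\<close>

lemma adjoint_on:
  assumes A: "bounded_clinear A" and M: "closed M" "csubspace M"
  shows adjoint_on_mem: "adjoint_on M A y \<in> M"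
    and cinner_adjoint_on: "x \<in> M \<Longrightarrow> cinner (A x) y = cinner x (adjoint_on M A y)"
proof -
  have "bounded_linear (\<lambda>x. inner (A x) y)"
    using bounded_linear_compose[OF bounded_linear_inner_left
        bounded_clinear_imp_bounded_linear[OF A]] by simp
  then obtain z where z: "z \<in> M" "\<And>x. x \<in> M \<Longrightarrow> inner (A x) y = inner x z"
    using riesz_on_closed_subspace M by (metis csubspace_def)
  have eq: "cinner (A x) y = cinner x z" if "x \<in> M" for x
  proof (rule complex_eqI)
    have "\<i> *\<^sub>C x \<in> M" using that M by (simp add: csubspace_def)
    then show "Im (cinner (A x) y) = Im (cinner x z)"
      using z(2) by (metis Im_cinner A bounded_clinear_scaleC_commute)
  qed (use z that in \<open>simp add: Re_cinner\<close>)
  have "adjoint_on M A y = z"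
    using adjoint_on_unique M z eq by blast
  then show "adjoint_on M A y \<in> M"
    and "x \<in> M \<Longrightarrow> cinner (A x) y = cinner x (adjoint_on M A y)"
    using z eq by auto
qed

lemma csubspace_UNIV: "csubspace UNIV"
  by (simp add: csubspace_def)

lemmas cinner_adjoint = cinner_adjoint_on[OF _ closed_UNIV csubspace_UNIV UNIV_I]

lemma bounded_clinear_adjoint:
  assumes A: "bounded_clinear A"
  shows "bounded_clinear (adjoint_on UNIV A)"
proof -
  let ?B = "adjoint_on UNIV A"
  have adj: "cinner (A x) y = cinner x (?B y)" for x y
    by (rule cinner_adjoint[OF A])
  then have real_adj: "inner (A x) y = inner x (?B y)" for x y
    by (metis Re_cinner)
  obtain K where K: "K > 0" "\<And>x. norm (A x) \<le> norm x * K"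
    using bounded_linear.pos_bounded[OF bounded_clinear_imp_bounded_linear[OF A]] by blast
  have "?B (y + z) = ?B y + ?B z" for y z
    by (rule vector_eq_rdot[THEN iffD1])
      (simp add: inner_add_right inner_commute flip: real_adj)
  moreover have "?B (r *\<^sub>R y) = r *\<^sub>R ?B y" for r y
    by (rule vector_eq_rdot[THEN iffD1]) (simp add: inner_commute flip: real_adj)
  moreover have "norm (?B y) \<le> norm y * K" for y
  proof (cases "?B y = 0")
    case False
    have "norm (?B y) * norm (?B y) = inner (A (?B y)) y"
      by (simp add: real_adj flip: power2_eq_square power2_norm_eq_inner)
    also have "\<dots> \<le> norm (A (?B y)) * norm y" by (rule norm_cauchy_schwarz)
    also have "\<dots> \<le> norm (?B y) * K * norm y"
      using K(2) by (simp add: mult_right_mono)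
    finally show ?thesis using False by (simp add: mult.commute mult.left_commute)
  qed (use K in simp)
  ultimately have "bounded_linear ?B" by (rule bounded_linear_intro)
  moreover have "?B (a *\<^sub>C y) = a *\<^sub>C ?B y" for a y
    by (rule adjoint_on_unique[OF csubspace_UNIV]) (simp_all add: cinner_scaleC_right adj)
  ultimately show ?thesis
    by (simp add: bounded_clinear_def clinear_def bounded_linear.linear)
qed

lemma cinner_funpow_adjoint:
  fixes A B :: "'a::complex_inner \<Rightarrow> 'a"
  assumes "\<And>x y. cinner (A x) y = cinner x (B y)"
  shows "cinner ((A ^^ n) x) y = cinner x ((B ^^ n) y)"
  by (induction n arbitrary: y) (simp_all add: assms flip: funpow_swap1)

section \<open>Bounded operators on closed spans\<close>

lemma subspace_closure:
  fixes X :: "'a::real_normed_vector set"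
  assumes "subspace X"
  shows "subspace (closure X)"
proof (rule subspaceI)
  show "0 \<in> closure X"
    using subspace_0[OF assms] closure_subset by blast
  fix x y assume "x \<in> closure X" "y \<in> closure X"
  then obtain f g where "\<forall>k. f k \<in> X" "f \<longlonglongrightarrow> x" "\<forall>k. g k \<in> X" "g \<longlonglongrightarrow> y"
    unfolding closure_sequential by blast
  then have "\<forall>k. f k + g k \<in> X" "(\<lambda>k. f k + g k) \<longlonglongrightarrow> x + y"
    by (simp_all add: subspace_add[OF assms] tendsto_add)
  then show "x + y \<in> closure X"
    unfolding closure_sequential by (intro exI[of _ "\<lambda>k. f k + g k"] conjI)
next
  fix r :: real and x assume "x \<in> closure X"
  then obtain f where "\<forall>k. f k \<in> X" "f \<longlonglongrightarrow> x"
    unfolding closure_sequential by blast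
  then have "\<forall>k. r *\<^sub>R f k \<in> X" "(\<lambda>k. r *\<^sub>R f k) \<longlonglongrightarrow> r *\<^sub>R x"
    by (simp_all add: subspace_scale[OF assms] tendsto_scaleR)
  then show "r *\<^sub>R x \<in> closure X"
    unfolding closure_sequential by (intro exI[of _ "\<lambda>k. r *\<^sub>R f k"] conjI)
qed

lemma image_closure_span_subset:
  assumes f: "bounded_linear f" and inv: "\<And>x. x \<in> X \<Longrightarrow> f x \<in> X"
  shows "f ` closure (span X) \<subseteq> closure (span X)"
proof -
  have "f ` span X = span (f ` X)"
    using linear_span_image[OF bounded_linear.linear[OF f]] by simp
  also have "\<dots> \<subseteq> span X"
    by (rule span_mono) (use inv in blast)
  finally have "f ` span X \<subseteq> closure (span X)"
    using closure_subset by blast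
  then show ?thesis
    by (intro image_closure_subset linear_continuous_on f closed_closure)
qed

lemma bounded_linear_eq_on_closure_span:
  assumes f: "bounded_linear f" and g: "bounded_linear g"
    and eq: "\<And>x. x \<in> X \<Longrightarrow> f x = g x" and x: "x \<in> closure (span X)"
  shows "f x = g x"
proof -
  have "closure (span X) \<subseteq> {x. f x = g x}"
  proof (rule closure_minimal)
    show "closed {x. f x = g x}"
      by (intro closed_Collect_eq linear_continuous_on f g)
    show "span X \<subseteq> {x. f x = g x}"
      using linear_eq_on_span[of f g X] f g eq by (auto simp: bounded_linear.linear)
  qed
  with x show ?thesis by auto
qed

text \<open>Approximate \<open>x\<close> by points of the domain: their partners form a Cauchy sequence by isometry,
  and the limit of the pairs stays in the closed set \<open>C\<close>.\<close>

lemma isometric_correspondence_total: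
  fixes C :: "('a::metric_space \<times> 'b::complete_space) set"
  assumes "closed C"
    and iso: "\<And>p q. p \<in> C \<Longrightarrow> q \<in> C \<Longrightarrow> dist (fst p) (fst q) = dist (snd p) (snd q)"
    and dense: "closure (fst ` C) = UNIV"
  shows "\<exists>y. (x, y) \<in> C"
proof -
  obtain X where X: "\<And>k. X k \<in> fst ` C" "X \<longlonglongrightarrow> x"
    using dense closure_sequential[of x "fst ` C"] by auto
  then have "\<exists>p. p \<in> C \<and> fst p = X k" for k
    by (metis imageE)
  then obtain p where p: "\<And>k. p k \<in> C" "\<And>k. fst (p k) = X k"
    by metis
  have "Cauchy X" using X(2) by (rule LIMSEQ_imp_Cauchy)
  then have "Cauchy (\<lambda>k. snd (p k))"
    using iso[OF p(1) p(1)] by (simp add: Cauchy_def p(2))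
  then obtain y where "(\<lambda>k. snd (p k)) \<longlonglongrightarrow> y"
    using Cauchy_convergent convergent_def by blast
  then have "(\<lambda>k. (fst (p k), snd (p k))) \<longlonglongrightarrow> (x, y)"
    using X(2) by (intro tendsto_Pair) (simp_all add: p(2))
  then have "(x, y) \<in> C"
    using closed_sequentially[OF \<open>closed C\<close>, of p] p(1) by simp
  then show ?thesis ..
qed

text \<open>The unitary is obtained as a graph: the closed span of \<open>G\<close> in the product space is again
  inner-product preserving and invariant under the two operators. It is total
  because its domain is dense and complete, the latter by completeness of the target space and
  isometry.\<close>

lemma unitarily_equivalent_if_correspondence:
  fixes G :: "('a::chilbert_space \<times> 'b::chilbert_space) set"
  assumes gram: "\<And>p q. p \<in> G \<Longrightarrow> q \<in> G \<Longrightarrow> inner (fst p) (fst q) = inner (snd p) (snd q)"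
    and scale: "\<And>a x y. (x, y) \<in> G \<Longrightarrow> (a *\<^sub>C x, a *\<^sub>C y) \<in> G"
    and intertwine: "\<And>x y. (x, y) \<in> G \<Longrightarrow> (S x, R y) \<in> G"
    and S: "bounded_linear S" and R: "bounded_linear R"
    and dense1: "closure (span (fst ` G)) = UNIV"
    and dense2: "closure (span (snd ` G)) = UNIV"
  shows "unitarily_equivalent S R"
proof -
  define C where "C = closure (span G)"
  have C: "closed C" "subspace C"
    by (simp_all add: C_def subspace_closure)
  note bounded = bounded_linear_compose[OF bounded_linear_inner_right]
    bounded_linear_compose[OF bounded_linear_inner_left]
  \<comment> \<open>extend the identity from \<open>G\<close> to \<open>C\<close> in one argument at a time\<close>
  have inner1: "inner (fst p) (fst q) = inner (snd p) (snd q)" if "p \<in> G" "q \<in> C" for p q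
    using bounded(1)[OF bounded_linear_fst] bounded(1)[OF bounded_linear_snd] gram[OF that(1)]
      that(2)[unfolded C_def]
    by (rule bounded_linear_eq_on_closure_span)
  have inner_C: "inner (fst p) (fst q) = inner (snd p) (snd q)" if "p \<in> C" "q \<in> C" for p q
    using bounded(2)[OF bounded_linear_fst] bounded(2)[OF bounded_linear_snd] inner1[OF _ that(2)]
      that(1)[unfolded C_def]
    by (rule bounded_linear_eq_on_closure_span)
  have norm_C: "norm (fst p) = norm (snd p)" if "p \<in> C" for p
    by (simp add: norm_eq_sqrt_inner inner_C that)
  have C_map: "(f x, g y) \<in> C"
    if "bounded_linear f" "bounded_linear g" "\<And>x y. (x, y) \<in> G \<Longrightarrow> (f x, g y) \<in> G" "(x, y) \<in> C"
    for f g x y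
  proof -
    have "bounded_linear (\<lambda>p. (f (fst p), g (snd p)))"
      using that(1,2)
      by (intro bounded_linear_Pair bounded_linear_compose[OF _ bounded_linear_fst]
          bounded_linear_compose[OF _ bounded_linear_snd])
    from image_closure_span_subset[OF this, of G] show ?thesis
      using that(3,4) by (force simp: C_def)
  qed
  have scale_C: "(a *\<^sub>C x, a *\<^sub>C y) \<in> C" if "(x, y) \<in> C" for a x y
    using bounded_clinear_imp_bounded_linear[OF bounded_clinear_scaleC]
      bounded_clinear_imp_bounded_linear[OF bounded_clinear_scaleC] scale that
    by (rule C_map)
  have intertwine_C: "(S x, R y) \<in> C" if "(x, y) \<in> C" for x y
    using S R intertwine that by (rule C_map)
  have diff_C: "p - q \<in> C" if "p \<in> C" "q \<in> C" for p q
    using that C by (simp add: subspace_diff)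
  have dist_C: "dist (fst p) (fst q) = dist (snd p) (snd q)" if "p \<in> C" "q \<in> C" for p q
    using norm_C[OF diff_C[OF that]] by (simp add: dist_norm)
  have dense_C: "closure (f ` C) = UNIV"
    if "bounded_linear f" "closure (span (f ` G)) = UNIV"
    for f :: "'a \<times> 'b \<Rightarrow> 'c::real_normed_vector"
  proof -
    have "span (f ` G) \<subseteq> f ` C"
      unfolding linear_span_image[OF bounded_linear.linear[OF that(1)]] C_def
      using closure_subset by blast
    then show ?thesis
      using that(2) closure_mono by blast
  qed
  have total: "\<exists>y. (x, y) \<in> C" for x
    using C(1) dist_C dense_C[OF bounded_linear_fst dense1]
    by (rule isometric_correspondence_total)
  have onto: "\<exists>x. (x, y) \<in> C" for y
  proof -
    have swap: "prod.swap -` C = {(y, x). (x, y) \<in> C}" by auto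
    have "closed (prod.swap -` C)"
      unfolding prod.swap_def
      by (intro closed_vimage C(1) continuous_intros)
    moreover have "dist (fst p) (fst q) = dist (snd p) (snd q)"
      if "p \<in> prod.swap -` C" "q \<in> prod.swap -` C" for p q
      using dist_C[of "prod.swap p" "prod.swap q"] that by simp
    moreover have "fst ` (prod.swap -` C) = snd ` C"
      by (force simp: swap)
    then have "closure (fst ` (prod.swap -` C)) = UNIV"
      using dense_C[OF bounded_linear_snd dense2] by simp
    ultimately have "\<exists>x. (y, x) \<in> prod.swap -` C"
      by (rule isometric_correspondence_total)
    then show ?thesis by simp
  qed
  define U where "U x = (SOME y. (x, y) \<in> C)" for x
  have U_C: "(x, U x) \<in> C" for x
    unfolding U_def using total by (rule someI_ex)
  have U_eq: "U x = y" if "(x, y) \<in> C" for x y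
    using dist_C[OF U_C[of x] that] by simp
  have "linear U"
  proof (rule linearI)
    show "U (x + y) = U x + U y" for x y
      using subspace_add[OF C(2) U_C[of x] U_C[of y]] by (intro U_eq) simp
    show "U (r *\<^sub>R x) = r *\<^sub>R U x" for r x
      using subspace_scale[OF C(2) U_C[of x], of r] by (intro U_eq) simp
  qed
  moreover have U_scale: "U (a *\<^sub>C x) = a *\<^sub>C U x" for a x
    using scale_C U_C U_eq by blast
  moreover have "cinner (U x) (U y) = cinner x y" for x y
  proof (rule complex_eqI)
    have inner_U: "inner (U x) (U y) = inner x y" for x y
      using inner_C[OF U_C U_C, of x y] by simp
    then show "Re (cinner (U x) (U y)) = Re (cinner x y)"
      by (simp add: Re_cinner)
    show "Im (cinner (U x) (U y)) = Im (cinner x y)"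
      by (simp add: Im_cinner inner_U flip: U_scale)
  qed
  ultimately have "isometric_embedding U"
    by (simp add: isometric_embedding_def clinear_def)
  moreover have "surj U"
    using onto U_eq by (metis surjI)
  moreover have "U (S x) = R (U x)" for x
    using intertwine_C U_C U_eq by blast
  ultimately show ?thesis
    unfolding unitarily_equivalent_def by blast
qed

section \<open>Minimal extensions\<close>

text \<open>The adjoint of the identity that defines \<open>n\<close>-normality, which has the roles of \<open>S\<close> and its
  adjoint exchanged.\<close>

lemma adjoint_power_commute:
  assumes S: "bounded_clinear S" and normal: "m_normal_on n UNIV S"
  defines "A \<equiv> adjoint_on UNIV S ^^ n"
  shows "A (S y) = S (A y)"
proof -
  let ?B = "adjoint_on UNIV S"
  have adj: "cinner (S x) y = cinner x (?B y)" for x y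
    by (rule cinner_adjoint[OF S])
  have adj': "cinner x (S y) = cinner (?B x) y" for x y
    by (metis adj cinner_commute)
  have adj_n: "cinner ((S ^^ n) x) y = cinner x (A y)" for x y
    unfolding A_def by (rule cinner_funpow_adjoint) (rule adj)
  have "cinner x (A (S y)) = cinner x (S (A y))" for x
  proof -
    have "cinner x (A (S y)) = cinner (?B ((S ^^ n) x)) y"
      by (simp add: adj' flip: adj_n)
    also have "\<dots> = cinner ((S ^^ n) (?B x)) y"
      using normal by (simp add: m_normal_on_def)
    also have "\<dots> = cinner x (S (A y))"
      by (simp add: adj' adj_n)
    finally show ?thesis .
  qed
  then show ?thesis
    using cinner_eq_imp_eq[of UNIV "A (S y)" "S (A y)"] by simp
qed

text \<open>Since \<open>M\<close> is invariant under the adjoint \<open>A\<close> of \<open>S ^^ n\<close>, vectors \<open>A y\<close> with \<open>y \<in> M\<close> are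
  admissible test vectors for the adjoint of \<open>S\<close> taken in \<open>M\<close>, although that adjoint is in general
  not the restriction of the one in the ambient space.\<close>

lemma m_normal_on_invariant_subspace:
  assumes S: "bounded_clinear S" and normal: "m_normal_on n UNIV S"
    and M: "closed M" "csubspace M" and SM: "S ` M \<subseteq> M"
    and AM: "(adjoint_on UNIV S ^^ n) ` M \<subseteq> M"
  shows "m_normal_on n M S"
  unfolding m_normal_on_def
proof
  let ?A = "adjoint_on UNIV S ^^ n" and ?B = "adjoint_on M S"
  fix x assume "x \<in> M"
  have adj_n: "cinner ((S ^^ n) x) y = cinner x (?A y)" for x y
    by (rule cinner_funpow_adjoint) (rule cinner_adjoint[OF S])
  have adj_n': "cinner x ((S ^^ n) y) = cinner (?A x) y" for x y
    by (metis adj_n cinner_commute)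
  have SnM: "(S ^^ k) v \<in> M" if "v \<in> M" for k v
    using SM that by (induction k) auto
  show "?B ((S ^^ n) x) = (S ^^ n) (?B x)"
  proof (rule adjoint_on_unique[OF M(2)])
    show "(S ^^ n) (?B x) \<in> M"
      by (intro SnM adjoint_on_mem S M)
    fix y assume "y \<in> M"
    have "cinner (S y) ((S ^^ n) x) = cinner (S (?A y)) x"
      using adjoint_power_commute[OF S normal] by (simp add: adj_n')
    also have "\<dots> = cinner (?A y) (?B x)"
      using AM \<open>y \<in> M\<close> by (intro cinner_adjoint_on S M) auto
    also have "\<dots> = cinner y ((S ^^ n) (?B x))"
      by (simp add: adj_n')
    finally show "cinner (S y) ((S ^^ n) x) = cinner y ((S ^^ n) (?B x))" .
  qed
qed

text \<open>These vectors span the candidate for the minimal extension inside any given one. They are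
  indexed by \<open>j\<close> and a vector of the space of \<open>T\<close> so that \<open>S\<close> and complex scalars act on the
  index alone; hence real spans suffice.\<close>

definition extension_vector ::
    "nat \<Rightarrow> ('h::chilbert_space \<Rightarrow> 'k::chilbert_space) \<Rightarrow> ('k \<Rightarrow> 'k) \<Rightarrow> nat \<Rightarrow> 'h \<Rightarrow> 'k" where
  "extension_vector n J S j h = ((adjoint_on UNIV S ^^ n) ^^ j) (J h)"

context
  fixes n :: nat and J :: "'h::chilbert_space \<Rightarrow> 'k::chilbert_space" and T S
  assumes ext: "m_normal_extension n J T S"
begin

lemma extension_facts:
  shows ext_bounded: "bounded_clinear S"
    and ext_normal: "m_normal_on n UNIV S"
    and ext_isometric: "isometric_embedding J"
    and ext_intertwine: "S (J x) = J (T x)"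
  using ext by (simp_all add: m_normal_extension_def m_normal_extension_on_def)

lemma extension_vector_scaleC:
  "a *\<^sub>C extension_vector n J S j h = extension_vector n J S j (a *\<^sub>C h)"
  using ext_isometric bounded_clinear_funpow[OF bounded_clinear_funpow[OF
      bounded_clinear_adjoint[OF ext_bounded]]]
  by (simp add: extension_vector_def isometric_embedding_def clinear_def
      bounded_clinear_scaleC_commute)

lemma extension_vector_apply:
  "S (extension_vector n J S j h) = extension_vector n J S j (T h)"
proof -
  have "S (((adjoint_on UNIV S ^^ n) ^^ j) v) = ((adjoint_on UNIV S ^^ n) ^^ j) (S v)" for v
    by (induction j) (simp_all flip: adjoint_power_commute[OF ext_bounded ext_normal])
  then show ?thesis
    by (simp add: extension_vector_def ext_intertwine)
qed

lemma extension_vector_apply_funpow: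
  "(S ^^ k) (extension_vector n J S j h) = extension_vector n J S j ((T ^^ k) h)"
  by (induction k) (simp_all add: extension_vector_apply)

text \<open>Move \<open>A ^^ k\<close> to the left factor, where it becomes \<open>S ^^ (n * k)\<close> and acts through \<open>T\<close> on the
  index; then do the same with \<open>A ^^ j\<close>. What remains is an inner product of vectors in the range of
  the isometry \<open>J\<close>.\<close>

lemma extension_gram:
  "cinner (extension_vector n J S j h) (extension_vector n J S k g)
    = cinner ((T ^^ (n * k)) h) ((T ^^ (n * j)) g)"
proof -
  let ?e = "extension_vector n J S"
  have adj: "cinner ((S ^^ (n * i)) x) y = cinner x (((adjoint_on UNIV S ^^ n) ^^ i) y)" for i x y
    unfolding funpow_mult[symmetric]
    by (intro cinner_funpow_adjoint cinner_adjoint[OF ext_bounded])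
  have e0: "?e 0 h = J h" for h
    by (simp add: extension_vector_def)
  have move: "cinner x (?e i g) = cinner ((S ^^ (n * i)) x) (J g)" for x i g
    by (simp add: adj extension_vector_def)
  have "cinner (?e j h) (?e k g) = cinner (?e j ((T ^^ (n * k)) h)) (J g)"
    by (simp add: move extension_vector_apply_funpow)
  also have "\<dots> = cnj (cinner (?e 0 g) (?e j ((T ^^ (n * k)) h)))"
    by (metis cinner_commute e0)
  also have "\<dots> = cnj (cinner (J ((T ^^ (n * j)) g)) (J ((T ^^ (n * k)) h)))"
    unfolding move extension_vector_apply_funpow by (metis e0 extension_vector_apply_funpow)
  also have "\<dots> = cinner ((T ^^ (n * k)) h) ((T ^^ (n * j)) g)"
    using ext_isometric by (metis isometric_embedding_def cinner_commute)
  finally show ?thesis .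
qed

end

text \<open>The closed span of the extension vectors carries an \<open>n\<close>-normal extension of \<open>T\<close>, so it is
  one of the subspaces over which minimality quantifies.\<close>

lemma minimal_extension_dense:
  assumes minimal: "minimal_m_normal_extension n J T S"
  shows "closure (span (range (\<lambda>(j, h). extension_vector n J S j h))) = UNIV"
proof -
  let ?X = "range (\<lambda>(j, h). extension_vector n J S j h)" and ?A = "adjoint_on UNIV S ^^ n"
  define M where "M = closure (span ?X)"
  have ext: "m_normal_extension n J T S"
    using minimal by (simp add: minimal_m_normal_extension_def)
  note S = ext_bounded[OF ext]
  have X: "extension_vector n J S j h \<in> ?X" for j h by force
  have invariant: "f ` M \<subseteq> M"
    if "bounded_clinear f" "\<And>j h. f (extension_vector n J S j h) \<in> ?X" for f
    unfolding M_def using that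
    by (intro image_closure_span_subset bounded_clinear_imp_bounded_linear) auto
  have SM: "S ` M \<subseteq> M"
    using X by (intro invariant S) (simp add: extension_vector_apply[OF ext])
  have "?A (extension_vector n J S j h) = extension_vector n J S (Suc j) h" for j h
    by (simp add: extension_vector_def)
  then have AM: "?A ` M \<subseteq> M"
    using X by (intro invariant bounded_clinear_funpow bounded_clinear_adjoint S) simp
  have scaleM: "(\<lambda>x. a *\<^sub>C x) ` M \<subseteq> M" for a
    using X by (intro invariant bounded_clinear_scaleC) (simp add: extension_vector_scaleC[OF ext])
  have M_subspace: "subspace M"
    by (simp add: M_def subspace_closure)
  have M: "closed M" "csubspace M"
    using M_subspace scaleM by (simp add: M_def, simp add: csubspace_def image_subset_iff)
  have "J h \<in> M" for h
  proof -
    have "J h \<in> ?X" using X[of 0 h] by (simp add: extension_vector_def)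
    then show ?thesis
      unfolding M_def by (rule subsetD[OF closure_subset, OF span_base])
  qed
  then have "range J \<subseteq> M" by (rule image_subsetI)
  then have "m_normal_extension_on n J T M S"
    unfolding m_normal_extension_on_def
    using M SM ext_isometric[OF ext] ext_intertwine[OF ext]
      m_normal_on_invariant_subspace[OF S ext_normal[OF ext] M SM AM]
    by (intro conjI allI)
  then show ?thesis
    using minimal by (simp add: minimal_m_normal_extension_def M_def)
qed

theorem proposition4p2:
  fixes n :: nat
    and T1 :: "'h1::chilbert_space \<Rightarrow> 'h1" and T2 :: "'h2::chilbert_space \<Rightarrow> 'h2"
    and S1 :: "'k1::chilbert_space \<Rightarrow> 'k1" and S2 :: "'k2::chilbert_space \<Rightarrow> 'k2"
    and J1 :: "'h1 \<Rightarrow> 'k1" and J2 :: "'h2 \<Rightarrow> 'k2"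
  assumes "n > 0"
    and "separable_space (euclidean :: 'h1 topology)"
    and "separable_space (euclidean :: 'h2 topology)"
    and "bounded_clinear T1" and "bounded_clinear T2"
    and "\<exists>(I::'h1 \<Rightarrow> 'l1::chilbert_space) R. \<forall>m\<ge>n. m_normal_extension m I T1 R"
    and "\<exists>(I::'h2 \<Rightarrow> 'l2::chilbert_space) R. \<forall>m\<ge>n. m_normal_extension m I T2 R"
    and "minimal_m_normal_extension n J1 T1 S1"
    and "minimal_m_normal_extension n J2 T2 S2"
    and "unitarily_equivalent T1 T2"
  shows "unitarily_equivalent S1 S2"
proof -
  obtain V :: "'h1 \<Rightarrow> 'h2" where V: "isometric_embedding V" "surj V"
    and intertwine: "\<And>x. V (T1 x) = T2 (V x)"
    using \<open>unitarily_equivalent T1 T2\<close> by (auto simp: unitarily_equivalent_def)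
  have ext1: "m_normal_extension n J1 T1 S1" and ext2: "m_normal_extension n J2 T2 S2"
    using assms by (simp_all add: minimal_m_normal_extension_def)
  let ?e1 = "extension_vector n J1 S1" and ?e2 = "extension_vector n J2 S2"
  define G where "G = range (\<lambda>(j, h). (?e1 j h, ?e2 j (V h)))"
  have G: "(?e1 j h, ?e2 j (V h)) \<in> G" for j h
    by (force simp: G_def)
  have G_E: thesis
    if "p \<in> G" "\<And>j h. p = (?e1 j h, ?e2 j (V h)) \<Longrightarrow> thesis" for p thesis
    using that by (auto simp: G_def)
  have V_funpow: "(T2 ^^ k) (V x) = V ((T1 ^^ k) x)" for k x
    by (induction k) (simp_all add: intertwine)
  show ?thesis
  proof (rule unitarily_equivalent_if_correspondence)
    fix p q assume "p \<in> G" "q \<in> G"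
    then show "inner (fst p) (fst q) = inner (snd p) (snd q)"
      using V(1) by (auto elim!: G_E simp: extension_gram[OF ext1] extension_gram[OF ext2] V_funpow
          isometric_embedding_def simp flip: Re_cinner)
  next
    fix a x y assume "(x, y) \<in> G"
    moreover have V_scale: "a *\<^sub>C V h = V (a *\<^sub>C h)" for h
      using V(1) by (simp add: isometric_embedding_def clinear_def)
    ultimately show "(a *\<^sub>C x, a *\<^sub>C y) \<in> G"
      using G by (auto elim!: G_E simp: extension_vector_scaleC[OF ext1]
          extension_vector_scaleC[OF ext2] V_scale)
  next
    fix x y assume "(x, y) \<in> G"
    then show "(S1 x, S2 y) \<in> G"
      using G by (auto elim!: G_E simp: extension_vector_apply[OF ext1]
          extension_vector_apply[OF ext2] simp flip: intertwine)
  next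
    show "bounded_linear S1" "bounded_linear S2"
      using ext_bounded[OF ext1] ext_bounded[OF ext2]
      by (simp_all add: bounded_clinear_imp_bounded_linear)
  next
    have "fst ` G = range (\<lambda>(j, h). ?e1 j h)"
      by (force simp: G_def)
    then show "closure (span (fst ` G)) = UNIV"
      using minimal_extension_dense[OF \<open>minimal_m_normal_extension n J1 T1 S1\<close>] by simp
  next
    have "?e2 j g \<in> snd ` G" for j g
    proof -
      obtain h where "g = V h" using \<open>surj V\<close> by blast
      then show ?thesis using G[of j h] by force
    qed
    then have "snd ` G = range (\<lambda>(j, h). ?e2 j h)"
      by (force simp: G_def)
    then show "closure (span (snd ` G)) = UNIV"
      using minimal_extension_dense[OF \<open>minimal_m_normal_extension n J2 T2 S2\<close>] by simp
  qed
qed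

end
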